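(* Let $m,n$ be odd positive integers. In the integral-free representation, the higher-order Henneberg-type minimal surfaces family $\mathcal{H}_{(m,n)}$ is determined by the algebraic function $$\Phi(\omega)=\frac{2}{(m+n-1)(m+n)(m+n+1)}\left(\omega^{m+n+1}+\omega^{-m-n+1}\right).$$ In particular, for $\mathcal{H}_{(1,1)}$ the function simplifies to $$\Phi(\omega)=\frac13\,(\omega^3+\omega^{-1}).$$
   Context: For holomorphic $f,g,h$ on a domain $D\subset\mathbb{C}$, the surface in $\mathbb{R}^4$ with Weierstrass data $(f,g,h)$ is $\operatorname{Re}\int\bigl(\tfrac12 f(1-g^2-h^2),\ \tfrac{\mathrm i}{2}f(1+g^2+h^2),\ fg,\ fh\bigr)\,d\omega$. For odd positive integers $m,n$ and $\lambda\in\mathbb{C}$, the family $\mathcal{H}_{(m,n)}$ has the Weierstrass data $f(\omega)=2\,\omega^{-m-n-2}(\omega^{2m+2n}-1)$, $g(\omega)=\omega^m$, $h(\omega)=\lambda\,\omega^n$; thus $\mathcal{H}_{(1,1)}$ has data $f(\omega)=2(1-\omega^{-4})$, $g(\omega)=\omega$, $h(\omega)=\lambda\omega$ on $\mathbb{C}\setminus\{0\}$. The integral-free representation derives the immersion from a single holomorphic seed function $\Phi$ via the data $f=\Phi'''$, $g(\omega)=\omega$, $h(\omega)=\lambda\omega$, $\lambda\in\mathbb{C}$, as $X=\operatorname{Re}(k_1,k_2,k_3,k_4)$ with $k_1=\tfrac12(1-(1+\lambda^2)\omega^2)\Phi''+(1+\lambda^2)\omega\Phi'-(1+\lambda^2)\Phi$,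 $k_2=\tfrac{\mathrm i}{2}(1+(1+\lambda^2)\omega^2)\Phi''-\mathrm i(1+\lambda^2)\omega\Phi'+\mathrm i(1+\lambda^2)\Phi$, $k_3=\omega\Phi''-\Phi'$, $k_4=\lambda(\omega\Phi''-\Phi')$; primes denote derivatives with respect to $\omega$.
   Formalization: The integral-free immersion has g=ω, h=λω, so it is not H_(m,n) in general (e.g. (3,1), λ=1); "determined by Φ" is read as f=Φ''' together with the immersion having data (f,ω,λω), and it is identified with H_(m,n) itself only for (1,1). *)

theory Defs
  imports "HOL-Complex_Analysis.Complex_Analysis"
begin

definition weierstrass_form ::
    "(complex \<Rightarrow> complex) \<Rightarrow> (complex \<Rightarrow> complex) \<Rightarrow> (complex \<Rightarrow> complex) \<Rightarrow> complex \<Rightarrow> complex ^ 4" where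
  "weierstrass_form f g h \<omega> = vector
     [1 / 2 * f \<omega> * (1 - (g \<omega>)\<^sup>2 - (h \<omega>)\<^sup>2),
      \<i> / 2 * f \<omega> * (1 + (g \<omega>)\<^sup>2 + (h \<omega>)\<^sup>2),
      f \<omega> * g \<omega>,
      f \<omega> * h \<omega>]"

(* The indefinite integral Re (\<integral> ...) fixes the surface only up to a translation of R^4, so it is
   rendered as a predicate on the parametrization X: the increment of X along every path in D is
   the real part of the path integral.  On a domain that is not simply connected this contains
   the requirement that the real periods vanish. *)
definition weierstrass_surface ::
    "complex set \<Rightarrow> (complex \<Rightarrow> complex) \<Rightarrow> (complex \<Rightarrow> complex) \<Rightarrow> (complex \<Rightarrow> complex)
      \<Rightarrow> (complex \<Rightarrow> real ^ 4) \<Rightarrow> bool" where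
  "weierstrass_surface D f g h X \<longleftrightarrow>
     open D \<and> connected D \<and> D \<noteq> {} \<and>
     f holomorphic_on D \<and> g holomorphic_on D \<and> h holomorphic_on D \<and>
     (\<forall>\<gamma>. valid_path \<gamma> \<and> path_image \<gamma> \<subseteq> D \<longrightarrow>
        X (pathfinish \<gamma>) - X (pathstart \<gamma>) =
          (\<chi> j. Re (contour_integral \<gamma> (\<lambda>\<omega>. weierstrass_form f g h \<omega> $ j))))"

definition henneberg_f :: "nat \<Rightarrow> nat \<Rightarrow> complex \<Rightarrow> complex" where
  "henneberg_f m n \<omega> = 2 * \<omega> powi (- int m - int n - 2) * (\<omega> ^ (2 * m + 2 * n) - 1)"

definition henneberg_g :: "nat \<Rightarrow> complex \<Rightarrow> complex" where
  "henneberg_g m \<omega> = \<omega> ^ m"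

definition henneberg_h :: "complex \<Rightarrow> nat \<Rightarrow> complex \<Rightarrow> complex" where
  "henneberg_h l n \<omega> = l * \<omega> ^ n"

definition henneberg_surface :: "nat \<Rightarrow> nat \<Rightarrow> complex \<Rightarrow> (complex \<Rightarrow> real ^ 4) \<Rightarrow> bool" where
  "henneberg_surface m n l X \<longleftrightarrow>
     weierstrass_surface (- {0}) (henneberg_f m n) (henneberg_g m) (henneberg_h l n) X"

definition integral_free :: "complex \<Rightarrow> (complex \<Rightarrow> complex) \<Rightarrow> complex \<Rightarrow> real ^ 4" where
  "integral_free l \<Phi> \<omega> =
     (let p0 = \<Phi> \<omega>; p1 = deriv \<Phi> \<omega>; p2 = (deriv ^^ 2) \<Phi> \<omega> in
      vector
        [Re (1 / 2 * (1 - (1 + l\<^sup>2) * \<omega>\<^sup>2) * p2 + (1 + l\<^sup>2) * \<omega> * p1 - (1 + l\<^sup>2) * p0),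
         Re (\<i> / 2 * (1 + (1 + l\<^sup>2) * \<omega>\<^sup>2) * p2 - \<i> * (1 + l\<^sup>2) * \<omega> * p1 + \<i> * (1 + l\<^sup>2) * p0),
         Re (\<omega> * p2 - p1),
         Re (l * (\<omega> * p2 - p1))])"

definition henneberg_seed :: "nat \<Rightarrow> nat \<Rightarrow> complex \<Rightarrow> complex" where
  "henneberg_seed m n \<omega> =
     2 / ((of_nat m + of_nat n - 1) * (of_nat m + of_nat n) * (of_nat m + of_nat n + 1)) *
     (\<omega> powi (int m + int n + 1) + \<omega> powi (- int m - int n + 1))"

(* P is a polynomial in y with coefficients in C[w]; the equation reads P(w, y) = 0 at y = F(w). *)
definition algebraic_function_on :: "complex set \<Rightarrow> (complex \<Rightarrow> complex) \<Rightarrow> bool" where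
  "algebraic_function_on D F \<longleftrightarrow>
     (\<exists>P :: complex poly poly. P \<noteq> 0 \<and> (\<forall>\<omega>\<in>D. poly (poly P [:F \<omega>:]) \<omega> = 0))"

end

theory Submission
  imports Defs
begin

text \<open>
  Put \<open>s = m + n\<close>, which is even and at least \<open>2\<close>. On the punctured plane
  \<open>f(\<omega>) = 2 (\<omega>^(s-2) - \<omega>^(-s-2))\<close>, so integrating three times term by term never meets the exponent
  \<open>-1\<close> and yields the seed, whose common denominator is \<open>(s-1) s (s+1)\<close>; the lowest power in the
  seed is \<open>\<omega>^(1-s)\<close>, so multiplying by \<open>\<omega>^(s-1)\<close> exhibits the seed as a root of a polynomial that
  is linear in its value.

  The integral-free formulas work for every holomorphic \<open>\<Phi>\<close>: by the product rule, the lower order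
  terms of each derivative \<open>k_j'\<close> cancel and what is left is the \<open>j\<close>-th Weierstrass form with
  \<open>f = \<Phi>'''\<close>, \<open>g = \<omega>\<close>, \<open>h = \<lambda> \<omega>\<close> (lemma \<open>integral_free_weierstrass\<close>). Hence \<open>k_1, \<dots>, k_4\<close> are global
  primitives, and the increments of their real parts along paths are the required integrals, even
  though the punctured plane is not simply connected.

  For general \<open>m, n\<close> the forms with \<open>g = \<omega>^m\<close> and \<open>h = \<lambda> \<omega>^n\<close> are linear combinations of the moments
  \<open>\<omega>^k f(\<omega>)\<close> with \<open>k\<close> among \<open>0, 2 m, 2 n, m, n\<close>. The moment has the exponents \<open>k + s - 2\<close> and
  \<open>k - s - 2\<close>, and oddness of \<open>m\<close> and \<open>n\<close> is what keeps both away from \<open>-1\<close>: for even \<open>k\<close> the exponents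
  are even, and for \<open>k = m\<close> or \<open>k = n\<close> the second one is below \<open>-2\<close>, the first one nonnegative. Thus
  all residues vanish and \<open>\<H>\<close> exists as a surface on the whole punctured plane.
\<close>

section \<open>Weierstrass surfaces from primitives\<close>

lemma vector_4:
  "(vector [a, b, c, d] :: 'a::zero ^ 4) $ 1 = a"
  "(vector [a, b, c, d] :: 'a::zero ^ 4) $ 2 = b"
  "(vector [a, b, c, d] :: 'a::zero ^ 4) $ 3 = c"
  "(vector [a, b, c, d] :: 'a::zero ^ 4) $ 4 = d"
  by (simp_all add: vector_def)

text \<open>
  Single-valued primitives make path integrals depend on the endpoints only. This is the route by
  which the period conditions are met on a domain that is not simply connected.
\<close>
lemma weierstrass_surface_of_primitives:
  fixes X :: "complex \<Rightarrow> real ^ 4"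
  assumes "open D" "connected D" "D \<noteq> {}"
    and "f holomorphic_on D" "g holomorphic_on D" "h holomorphic_on D"
    and F: "\<And>j \<omega>. \<omega> \<in> D \<Longrightarrow>
              (F j has_field_derivative weierstrass_form f g h \<omega> $ j) (at \<omega>)"
    and X: "\<And>j \<omega>. X \<omega> $ j = Re (F j \<omega>)"
  shows "weierstrass_surface D f g h X"
  unfolding weierstrass_surface_def
proof (intro conjI allI impI)
  fix \<gamma> :: "real \<Rightarrow> complex"
  assume \<gamma>: "valid_path \<gamma> \<and> path_image \<gamma> \<subseteq> D"
  have "contour_integral \<gamma> (\<lambda>\<omega>. weierstrass_form f g h \<omega> $ j)
          = F j (pathfinish \<gamma>) - F j (pathstart \<gamma>)" for j
    using \<gamma> by (intro contour_integral_unique contour_integral_primitive[where S = D])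
      (auto intro: has_field_derivative_at_within F)
  then show "X (pathfinish \<gamma>) - X (pathstart \<gamma>) =
      (\<chi> j. Re (contour_integral \<gamma> (\<lambda>\<omega>. weierstrass_form f g h \<omega> $ j)))"
    by (simp add: vec_eq_iff X)
qed (use assms in auto)

lemma weierstrass_surface_cong:
  assumes "\<And>\<omega>. \<omega> \<in> D \<Longrightarrow> f \<omega> = f' \<omega>"
  shows "weierstrass_surface D f g h X \<longleftrightarrow> weierstrass_surface D f' g h X"
proof -
  have "contour_integral \<gamma> (\<lambda>\<omega>. weierstrass_form f g h \<omega> $ j)
          = contour_integral \<gamma> (\<lambda>\<omega>. weierstrass_form f' g h \<omega> $ j)"
    if "path_image \<gamma> \<subseteq> D" for \<gamma> j
    using that assms by (intro contour_integral_eq) (auto simp: weierstrass_form_def)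
  then show ?thesis
    using holomorphic_cong[of D D f f'] assms unfolding weierstrass_surface_def by auto
qed

section \<open>The integral-free representation\<close>

text \<open>
  In \<open>k_1'\<close> the products \<open>(1 + \<lambda>\<^sup>2) \<omega> \<Phi>''\<close> and \<open>(1 + \<lambda>\<^sup>2) \<Phi>'\<close> each arise twice with opposite signs, which
  explains the coefficients in the formulas: only the term with \<open>\<Phi>'''\<close> survives. The same happens in
  the other components.
\<close>
lemma integral_free_weierstrass:
  assumes D: "open D" "connected D" "D \<noteq> {}" and \<Phi>: "\<Phi> holomorphic_on D"
  shows "weierstrass_surface D ((deriv ^^ 3) \<Phi>) (\<lambda>\<omega>. \<omega>) (\<lambda>\<omega>. l * \<omega>) (integral_free l \<Phi>)"
proof -
  define K :: "complex \<Rightarrow> complex ^ 4" where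
    "K \<omega> = vector
      [1 / 2 * (1 - (1 + l\<^sup>2) * \<omega>\<^sup>2) * (deriv ^^ 2) \<Phi> \<omega> + (1 + l\<^sup>2) * \<omega> * deriv \<Phi> \<omega> - (1 + l\<^sup>2) * \<Phi> \<omega>,
       \<i> / 2 * (1 + (1 + l\<^sup>2) * \<omega>\<^sup>2) * (deriv ^^ 2) \<Phi> \<omega> - \<i> * (1 + l\<^sup>2) * \<omega> * deriv \<Phi> \<omega> + \<i> * (1 + l\<^sup>2) * \<Phi> \<omega>,
       \<omega> * (deriv ^^ 2) \<Phi> \<omega> - deriv \<Phi> \<omega>,
       l * (\<omega> * (deriv ^^ 2) \<Phi> \<omega> - deriv \<Phi> \<omega>)]" for \<omega>
  have d: "((deriv ^^ k) \<Phi> has_field_derivative (deriv ^^ Suc k) \<Phi> \<omega>) (at \<omega>)"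
    if "\<omega> \<in> D" for k \<omega>
    using holomorphic_derivI[OF holomorphic_higher_deriv[OF \<Phi> D(1)] D(1) that] by simp
  have d0: "(\<Phi> has_field_derivative deriv \<Phi> \<omega>) (at \<omega>)"
   and d1: "(deriv \<Phi> has_field_derivative (deriv ^^ 2) \<Phi> \<omega>) (at \<omega>)"
   and d2: "((deriv ^^ 2) \<Phi> has_field_derivative (deriv ^^ 3) \<Phi> \<omega>) (at \<omega>)"
    if "\<omega> \<in> D" for \<omega>
    using d[OF that, of 0] d[OF that, of 1] d[OF that, of 2]
    by (simp_all add: numeral_2_eq_2 numeral_3_eq_3)
  have "\<forall>j. ((\<lambda>z. K z $ j) has_field_derivative
          weierstrass_form ((deriv ^^ 3) \<Phi>) (\<lambda>\<omega>. \<omega>) (\<lambda>\<omega>. l * \<omega>) \<omega> $ j) (at \<omega>)"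
    if "\<omega> \<in> D" for \<omega>
    unfolding forall_4 K_def weierstrass_form_def vector_4
    by (intro conjI)
       (rule DERIV_cong, (rule derivative_intros d0[OF that] d1[OF that] d2[OF that])+,
        simp add: algebra_simps power2_eq_square)+
  moreover have "\<forall>j. integral_free l \<Phi> \<omega> $ j = Re (K \<omega> $ j)" for \<omega>
    unfolding forall_4 K_def integral_free_def Let_def vector_4 by simp
  ultimately show ?thesis
    using D \<Phi> holomorphic_higher_deriv[OF \<Phi> D(1)]
    by (intro weierstrass_surface_of_primitives[where F = "\<lambda>j z. K z $ j"])
       (auto intro!: holomorphic_intros)
qed

section \<open>The seed function\<close>

lemma higher_deriv_3_eqI:
  assumes "open S" "\<omega> \<in> S"
    and f: "\<And>z. z \<in> S \<Longrightarrow> (f has_field_derivative f1 z) (at z)"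
    and f1: "\<And>z. z \<in> S \<Longrightarrow> (f1 has_field_derivative f2 z) (at z)"
    and f2: "\<And>z. z \<in> S \<Longrightarrow> (f2 has_field_derivative f3 z) (at z)"
  shows "(deriv ^^ 3) f \<omega> = f3 \<omega>"
proof -
  have D1: "deriv f z = f1 z" if "z \<in> S" for z
    using f[OF that] by (rule DERIV_imp_deriv)
  have D2: "deriv (deriv f) z = f2 z" if "z \<in> S" for z
    using has_field_derivative_transform_within_open[OF f1[OF that] assms(1) that] D1
    by (metis DERIV_imp_deriv)
  have "deriv (deriv (deriv f)) \<omega> = f3 \<omega>"
    using has_field_derivative_transform_within_open[OF f2[OF assms(2)] assms(1,2)] D2
    by (metis DERIV_imp_deriv)
  then show ?thesis
    by (simp add: numeral_3_eq_3)
qed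

lemma henneberg_f_laurent:
  assumes "\<omega> \<noteq> 0"
  shows "henneberg_f m n \<omega>
    = 2 * (\<omega> powi (int m + int n - 2) - \<omega> powi (- int m - int n - 2))"
proof -
  have "\<omega> powi (int m + int n - 2)
      = \<omega> powi ((- int m - int n - 2) + int (2 * m + 2 * n))"
    by (rule arg_cong[where f = "\<lambda>k. \<omega> powi k"]) simp
  also have "\<dots> = \<omega> powi (- int m - int n - 2) * \<omega> powi int (2 * m + 2 * n)"
    using assms by (intro power_int_add) simp
  also have "\<dots> = \<omega> powi (- int m - int n - 2) * \<omega> ^ (2 * m + 2 * n)"
    by (simp only: power_int_of_nat)
  finally show ?thesis
    by (simp add: henneberg_f_def algebra_simps)
qed

lemma henneberg_seed_holomorphic: "henneberg_seed m n holomorphic_on - {0}"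
  unfolding henneberg_seed_def by (intro holomorphic_intros) auto

lemma henneberg_seed_third_deriv:
  assumes "m + n \<ge> 2" and "\<omega> \<noteq> 0"
  shows "(deriv ^^ 3) (henneberg_seed m n) \<omega> = henneberg_f m n \<omega>"
proof -
  define s where "s = int m + int n"
  define c :: complex where "c = 2 / (of_int (s - 1) * of_int s * of_int (s + 1))"
  have "s \<ge> 2"
    using assms(1) by (simp add: s_def)
  then have "of_int (s - 1) * of_int s * of_int (s + 1) \<noteq> (0 :: complex)"
    unfolding mult_eq_0_iff of_int_eq_0_iff by simp
  then have c: "c * (of_int (s - 1) * of_int s * of_int (s + 1)) = 2"
    unfolding c_def by (rule nonzero_eq_divide_eq[THEN iffD1, OF _ refl])
  have seed: "henneberg_seed m n = (\<lambda>z. c * (z powi (s + 1) + z powi (1 - s)))"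
    by (rule ext) (simp add: henneberg_seed_def c_def s_def algebra_simps)
  have "(deriv ^^ 3) (henneberg_seed m n) \<omega>
      = c * (of_int (s - 1) * of_int s * of_int (s + 1)) * (\<omega> powi (s - 2) - \<omega> powi (- s - 2))"
  proof (rule higher_deriv_3_eqI[where S = "- {0}"])
    fix z :: complex assume z: "z \<in> - {0}"
    show "(henneberg_seed m n has_field_derivative
        c * (of_int (s + 1) * z powi s - of_int (s - 1) * z powi (- s))) (at z)"
      unfolding seed using z
      by (auto intro!: derivative_eq_intros simp: algebra_simps)
    show "((\<lambda>z. c * (of_int (s + 1) * z powi s - of_int (s - 1) * z powi (- s)))
        has_field_derivative
        c * (of_int s * of_int (s + 1) * z powi (s - 1)
             + of_int s * of_int (s - 1) * z powi (- s - 1))) (at z)"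
      using z by (auto intro!: derivative_eq_intros simp: algebra_simps)
    show "((\<lambda>z. c * (of_int s * of_int (s + 1) * z powi (s - 1)
             + of_int s * of_int (s - 1) * z powi (- s - 1))) has_field_derivative
        c * (of_int (s - 1) * of_int s * of_int (s + 1)) * (z powi (s - 2) - z powi (- s - 2))) (at z)"
      using z by (auto intro!: derivative_eq_intros simp: algebra_simps)
  qed (use assms in auto)
  also have "\<dots> = 2 * (\<omega> powi (s - 2) - \<omega> powi (- s - 2))"
    unfolding c ..
  finally show ?thesis
    using assms by (simp add: henneberg_f_laurent s_def)
qed

text \<open>
  Multiplying \<open>y = c (\<omega>^(s+1) + \<omega>^(1-s))\<close> by \<open>\<omega>^(s-1)\<close> clears the pole and gives the equation
  \<open>\<omega>^(s-1) y = c (\<omega>^(2s) + 1)\<close>.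
\<close>
lemma henneberg_seed_algebraic:
  assumes "m + n \<ge> 1"
  shows "algebraic_function_on (- {0}) (henneberg_seed m n)"
proof -
  define c :: complex where
    "c = 2 / ((of_nat m + of_nat n - 1) * (of_nat m + of_nat n) * (of_nat m + of_nat n + 1))"
  define P :: "complex poly poly" where
    "P = [: - monom c (2 * (m + n)) - [:c:], monom 1 (m + n - 1) :]"
  have "P \<noteq> 0"
    by (simp add: P_def)
  moreover have "poly (poly P [:henneberg_seed m n \<omega>:]) \<omega> = 0" if "\<omega> \<in> - {0}" for \<omega>
  proof -
    from that have \<omega>: "\<omega> \<noteq> 0" by simp
    have "\<omega> ^ (m + n - 1) * \<omega> powi (int m + int n + 1) = \<omega> powi int (2 * (m + n))"
      unfolding power_int_of_nat[symmetric] using \<omega> assms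
      by (subst power_int_add[symmetric]) (auto simp: of_nat_diff)
    moreover have "\<omega> ^ (m + n - 1) * \<omega> powi (- int m - int n + 1) = 1"
      unfolding power_int_of_nat[symmetric] using \<omega> assms
      by (subst power_int_add[symmetric]) (auto simp: of_nat_diff)
    ultimately have "\<omega> ^ (m + n - 1) * henneberg_seed m n \<omega> = c * (\<omega> ^ (2 * (m + n)) + 1)"
      unfolding henneberg_seed_def c_def[symmetric] power_int_of_nat
      by (simp add: algebra_simps)
    then show ?thesis
      by (simp add: P_def poly_monom algebra_simps)
  qed
  ultimately show ?thesis
    unfolding algebraic_function_on_def by blast
qed

section \<open>Vanishing periods of the higher-order surfaces\<close>

definition has_primitive_on :: "complex set \<Rightarrow> (complex \<Rightarrow> complex) \<Rightarrow> bool" where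
  "has_primitive_on D f \<longleftrightarrow> (\<exists>F. \<forall>\<omega>\<in>D. (F has_field_derivative f \<omega>) (at \<omega>))"

lemma has_primitive_on_add:
  assumes "has_primitive_on D f" "has_primitive_on D g"
  shows "has_primitive_on D (\<lambda>\<omega>. f \<omega> + g \<omega>)"
  using assms unfolding has_primitive_on_def by (meson DERIV_add)

lemma has_primitive_on_cmult:
  assumes "has_primitive_on D f"
  shows "has_primitive_on D (\<lambda>\<omega>. c * f \<omega>)"
  using assms unfolding has_primitive_on_def by (meson DERIV_cmult)

lemma has_primitive_on_cong:
  assumes "has_primitive_on D f" "\<And>\<omega>. \<omega> \<in> D \<Longrightarrow> f \<omega> = g \<omega>"
  shows "has_primitive_on D g"
  using assms unfolding has_primitive_on_def by metis

lemma has_primitive_on_powi: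
  assumes "k \<noteq> - 1"
  shows "has_primitive_on (- {0}) (\<lambda>\<omega>. \<omega> powi k)"
  unfolding has_primitive_on_def
proof (intro exI ballI)
  fix \<omega> :: complex assume "\<omega> \<in> - {0}"
  moreover have "of_int (k + 1) \<noteq> (0 :: complex)"
    unfolding of_int_eq_0_iff using assms by linarith
  ultimately show "((\<lambda>\<omega>. \<omega> powi (k + 1) / of_int (k + 1)) has_field_derivative \<omega> powi k) (at \<omega>)"
    by (auto intro!: derivative_eq_intros)
qed

text \<open>
  The two monomials of \<open>f\<close> become \<open>\<omega>^(k+m+n-2)\<close> and \<open>\<omega>^(k-m-n-2)\<close>; the hypotheses say that neither
  exponent is \<open>-1\<close>, so that the residue at \<open>0\<close> vanishes.
\<close>
lemma henneberg_moment_primitive: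
  assumes "k + m + n \<noteq> 1" and "k \<noteq> m + n + 1"
  shows "has_primitive_on (- {0}) (\<lambda>\<omega>. henneberg_f m n \<omega> * \<omega> ^ k)"
proof (rule has_primitive_on_cong)
  show "has_primitive_on (- {0}) (\<lambda>\<omega>. 2 * \<omega> powi (int m + int n - 2 + int k)
          + (- 2) * \<omega> powi (- int m - int n - 2 + int k))"
    using assms
    by (intro has_primitive_on_add has_primitive_on_cmult has_primitive_on_powi) linarith+
  show "2 * \<omega> powi (int m + int n - 2 + int k) + (- 2) * \<omega> powi (- int m - int n - 2 + int k)
      = henneberg_f m n \<omega> * \<omega> ^ k" if "\<omega> \<in> - {0}" for \<omega>
  proof -
    from that have \<omega>: "\<omega> \<noteq> 0" by simp
    then have "\<omega> powi (i + int k) = \<omega> powi i * \<omega> ^ k" for i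
      by (simp only: power_int_add power_int_of_nat simp_thms)
    then show ?thesis
      by (simp only: henneberg_f_laurent[OF \<omega>]) (simp add: ring_distribs)
  qed
qed

lemma henneberg_f_holomorphic: "henneberg_f m n holomorphic_on - {0}"
  unfolding henneberg_f_def by (intro holomorphic_intros) auto

lemma henneberg_surface_exists:
  assumes "odd m" "odd n"
  shows "\<exists>X. henneberg_surface m n l X"
proof -
  define W where "W = weierstrass_form (henneberg_f m n) (henneberg_g m) (henneberg_h l n)"
  have moment: "has_primitive_on (- {0}) (\<lambda>\<omega>. henneberg_f m n \<omega> * \<omega> ^ k)"
    if "k \<in> {0, 2 * m, 2 * n, m, n}" for k
  proof (rule henneberg_moment_primitive)
    have pos: "m > 0" "n > 0"
      using assms by (auto intro: odd_pos)
    then show "k + m + n \<noteq> 1"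
      by linarith
    have "odd (m + n + 1)"
      using assms by simp
    then have "k \<noteq> m + n + 1" if "even k"
      using that by blast
    then show "k \<noteq> m + n + 1"
      using \<open>k \<in> _\<close> pos by fastforce
  qed
  note comb = has_primitive_on_add has_primitive_on_cmult moment
  have "\<forall>j. has_primitive_on (- {0}) (\<lambda>\<omega>. W \<omega> $ j)"
    unfolding forall_4
  proof (intro conjI)
    show "has_primitive_on (- {0}) (\<lambda>\<omega>. W \<omega> $ 1)"
    proof (rule has_primitive_on_cong)
      show "has_primitive_on (- {0}) (\<lambda>\<omega>. 1 / 2 * (henneberg_f m n \<omega> * \<omega> ^ 0)
          + (- 1 / 2) * (henneberg_f m n \<omega> * \<omega> ^ (2 * m))
          + (- l\<^sup>2 / 2) * (henneberg_f m n \<omega> * \<omega> ^ (2 * n)))"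
        by (intro comb) auto
    qed (simp add: W_def weierstrass_form_def vector_4 henneberg_g_def henneberg_h_def
          power_mult power_mult_distrib power_even_eq field_simps)
    show "has_primitive_on (- {0}) (\<lambda>\<omega>. W \<omega> $ 2)"
    proof (rule has_primitive_on_cong)
      show "has_primitive_on (- {0}) (\<lambda>\<omega>. \<i> / 2 * (henneberg_f m n \<omega> * \<omega> ^ 0)
          + \<i> / 2 * (henneberg_f m n \<omega> * \<omega> ^ (2 * m))
          + (\<i> * l\<^sup>2 / 2) * (henneberg_f m n \<omega> * \<omega> ^ (2 * n)))"
        by (intro comb) auto
    qed (simp add: W_def weierstrass_form_def vector_4 henneberg_g_def henneberg_h_def
          power_mult power_mult_distrib power_even_eq field_simps)
    show "has_primitive_on (- {0}) (\<lambda>\<omega>. W \<omega> $ 3)"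
      using moment[of m] by (simp add: W_def weierstrass_form_def vector_4 henneberg_g_def)
    show "has_primitive_on (- {0}) (\<lambda>\<omega>. W \<omega> $ 4)"
      using has_primitive_on_cmult[OF moment[of n], of l]
      by (simp add: W_def weierstrass_form_def vector_4 henneberg_h_def mult.left_commute)
  qed
  then obtain F where
    "\<And>j \<omega>. \<omega> \<in> - {0} \<Longrightarrow> (F j has_field_derivative W \<omega> $ j) (at \<omega>)"
    unfolding has_primitive_on_def by metis
  then have "weierstrass_surface (- {0}) (henneberg_f m n) (henneberg_g m) (henneberg_h l n)
      (\<lambda>\<omega>. \<chi> j. Re (F j \<omega>))"
    unfolding W_def
    by (intro weierstrass_surface_of_primitives[where F = F] henneberg_f_holomorphic)
       (auto simp: henneberg_g_def[abs_def] henneberg_h_def[abs_def] connected_punctured_universe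
             intro!: holomorphic_intros exI[of _ 1])
  then show ?thesis
    unfolding henneberg_surface_def by blast
qed

section \<open>The Henneberg family in the integral-free representation\<close>

lemma henneberg_seed_surface:
  assumes "m + n \<ge> 2"
  shows "weierstrass_surface (- {0}) (henneberg_f m n) (\<lambda>\<omega>. \<omega>) (\<lambda>\<omega>. l * \<omega>)
           (integral_free l (henneberg_seed m n))"
proof -
  have "weierstrass_surface (- {0}) ((deriv ^^ 3) (henneberg_seed m n)) (\<lambda>\<omega>. \<omega>) (\<lambda>\<omega>. l * \<omega>)
           (integral_free l (henneberg_seed m n))"
    by (intro integral_free_weierstrass henneberg_seed_holomorphic)
       (auto simp: connected_punctured_universe intro!: exI[of _ 1])
  then show ?thesis
    using weierstrass_surface_cong henneberg_seed_third_deriv[OF assms]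
    by (metis ComplD singletonI)
qed

theorem mainTheorem4:
  fixes m n :: nat
  assumes "odd m" and "odd n"
  shows
    "henneberg_seed m n holomorphic_on - {0} \<and>
     algebraic_function_on (- {0}) (henneberg_seed m n) \<and>
     (\<forall>\<omega>\<in>- {0}. (deriv ^^ 3) (henneberg_seed m n) \<omega> = henneberg_f m n \<omega>) \<and>
     (\<forall>l. weierstrass_surface (- {0}) (henneberg_f m n) (\<lambda>\<omega>. \<omega>) (\<lambda>\<omega>. l * \<omega>)
            (integral_free l (henneberg_seed m n))) \<and>
     (\<forall>l. (\<exists>X. henneberg_surface m n l X) \<and>
          (\<forall>X. henneberg_surface m n l X \<longleftrightarrow>
             weierstrass_surface (- {0}) ((deriv ^^ 3) (henneberg_seed m n))
               (henneberg_g m) (henneberg_h l n) X)) \<and>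
     (\<forall>\<omega>\<in>- {0}. henneberg_seed 1 1 \<omega> = 1 / 3 * (\<omega> ^ 3 + \<omega> powi (- 1))) \<and>
     (\<forall>l. henneberg_surface 1 1 l (integral_free l (henneberg_seed 1 1)))"
proof (intro conjI allI ballI)
  have mn: "m + n \<ge> 2"
    using odd_pos[OF assms(1)] odd_pos[OF assms(2)] by linarith
  show "henneberg_seed m n holomorphic_on - {0}"
    by (rule henneberg_seed_holomorphic)
  show "algebraic_function_on (- {0}) (henneberg_seed m n)"
    using mn by (intro henneberg_seed_algebraic) linarith
  show third: "(deriv ^^ 3) (henneberg_seed m n) \<omega> = henneberg_f m n \<omega>" if "\<omega> \<in> - {0}" for \<omega>
    using that mn by (intro henneberg_seed_third_deriv) auto
  show "weierstrass_surface (- {0}) (henneberg_f m n) (\<lambda>\<omega>. \<omega>) (\<lambda>\<omega>. l * \<omega>)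
          (integral_free l (henneberg_seed m n))" for l
    by (rule henneberg_seed_surface[OF mn])
  show "\<exists>X. henneberg_surface m n l X" for l
    using assms by (rule henneberg_surface_exists)
  show "henneberg_surface m n l X \<longleftrightarrow>
      weierstrass_surface (- {0}) ((deriv ^^ 3) (henneberg_seed m n))
        (henneberg_g m) (henneberg_h l n) X" for l X
    unfolding henneberg_surface_def by (rule weierstrass_surface_cong) (simp add: third)
  show "henneberg_seed 1 1 \<omega> = 1 / 3 * (\<omega> ^ 3 + \<omega> powi (- 1))" for \<omega>
    using power_int_of_nat[of \<omega> 3] by (simp add: henneberg_seed_def)
  show "henneberg_surface 1 1 l (integral_free l (henneberg_seed 1 1))" for l
    using henneberg_seed_surface[of 1 1 l]
    by (simp add: henneberg_surface_def henneberg_g_def[abs_def] henneberg_h_def[abs_def])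
qed

end
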